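(* Assume that $\{\omega_x\}_{x\in\mathbb{Z}}$ are i.i.d. under $P$ with $P(\omega_0\in[c,1-c])=1$ for some $c>0$, and that $E_P[\rho_0]<1$, where $\rho_x=\frac{1-\omega_x}{\omega_x}$. Let $\alpha>0$ and let $\pi_\alpha(\omega)=\mathrm{Poisson}(\alpha f(\omega))$ with $f(\omega)=\frac{1}{\omega_0}\left(1+\sum_{i=1}^\infty\prod_{j=1}^i\rho_j\right)$. Then for $P$-a.e. environment $\omega$, $\pi_\alpha^\omega=\bigotimes_{x\in\mathbb{Z}}\pi_\alpha(\theta^x\omega)$ is a stationary distribution for the sequence of random variables $\eta_n$ under the quenched dynamics; that is, if $\eta_0\sim\pi_\alpha^\omega$, then $\eta_n\sim\pi_\alpha^\omega$ for any $n\in\mathbb{N}$ as well.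
   Context: An environment is an element $\omega=\{\omega_x\}_{x\in\mathbb{Z}}$ of $\Omega=[0,1]^{\mathbb{Z}}$. Given $\omega$, under the quenched law $P_\omega$, $\{X^{x,i}_\cdot\}_{x\in\mathbb{Z},\,i\ge 1}$ is an independent collection of nearest-neighbor Markov chains on $\mathbb{Z}$ with $P_\omega(X^{x,i}_0=x)=1$, and from a site $y$ each chain steps to $y+1$ with probability $\omega_y$ and to $y-1$ with probability $1-\omega_y$. $P$ is a probability measure on $\Omega$ with expectation $E_P$. The shift is $(\theta^x\omega)_y=\omega_{x+y}$. Given $\omega$ and an initial configuration $\eta_0\in(\mathbb{Z}_+)^{\mathbb{Z}}$ ($\mathbb{Z}_+$ the non-negative integers) that is independent of the walks, $\eta_n(x)=\sum_{y\in\mathbb{Z}}\sum_{i=1}^{\eta_0(y)}\mathbf{1}\{X^{y,i}_n=x\}$ is the number of particles at $x$ at time $n$. Under the stated assumptions $f(\theta^x\omega)<\infty$ for all $x\in\mathbb{Z}$, $P$-a.s. The product distribution $\pi_\alpha^\omega$ is the law on $(\mathbb{Z}_+)^{\mathbb{Z}}$ under which the coordinates $\eta_0(x)$ are independent with $\eta_0(x)\sim\mathrm{Poisson}(\alpha f(\theta^x\omega))$. *)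

theory Defs
  imports "HOL-Probability.Probability"
begin

text \<open>The measurable space \<open>\<Omega> = [0,1]\<^sup>\<int>\<close> with its product sigma-algebra; its elements are exactly
  the functions \<open>int \<Rightarrow> real\<close> with values in the unit interval.\<close>

definition env_space :: "(int \<Rightarrow> real) measure" where
  "env_space = PiM UNIV (\<lambda>_. restrict_space borel {0..1})"

definition iid_env :: "(int \<Rightarrow> real) measure \<Rightarrow> bool" where
  "iid_env P \<longleftrightarrow>
     prob_space.indep_vars P (\<lambda>_. borel) (\<lambda>x \<omega>. \<omega> x) (UNIV :: int set) \<and>
     (\<forall>x. distr P borel (\<lambda>\<omega>. \<omega> x) = distr P borel (\<lambda>\<omega>. \<omega> 0))"

definition shift :: "int \<Rightarrow> (int \<Rightarrow> real) \<Rightarrow> (int \<Rightarrow> real)" where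
  "shift x \<omega> = (\<lambda>y. \<omega> (x + y))"

definition rho :: "(int \<Rightarrow> real) \<Rightarrow> int \<Rightarrow> real" where
  "rho \<omega> x = (1 - \<omega> x) / \<omega> x"

text \<open>The series is indexed from 0, so that its \<open>i\<close>-th term is the product over \<open>1 \<le> j \<le> i + 1\<close>.
  The value is meaningful only for environments for which the series converges.\<close>

definition env_f :: "(int \<Rightarrow> real) \<Rightarrow> real" where
  "env_f \<omega> = 1 / \<omega> 0 * (1 + (\<Sum>i. \<Prod>j = 1..Suc i. rho \<omega> (int j)))"

definition config_space :: "(int \<Rightarrow> nat) measure" where
  "config_space = PiM UNIV (\<lambda>_. count_space UNIV)"

definition site_law :: "real \<Rightarrow> (int \<Rightarrow> real) \<Rightarrow> nat pmf" where
  "site_law \<alpha> \<omega> = poisson_pmf (\<alpha> * env_f \<omega>)"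

definition config_law :: "real \<Rightarrow> (int \<Rightarrow> real) \<Rightarrow> (int \<Rightarrow> nat) measure" where
  "config_law \<alpha> \<omega> = PiM UNIV (\<lambda>x. measure_pmf (site_law \<alpha> (shift x \<omega>)))"

definition step_prob :: "(int \<Rightarrow> real) \<Rightarrow> int \<Rightarrow> int \<Rightarrow> real" where
  "step_prob \<omega> y z = (if z = y + 1 then \<omega> y else if z = y - 1 then 1 - \<omega> y else 0)"

definition rw_in_env ::
    "'a measure \<Rightarrow> (int \<Rightarrow> real) \<Rightarrow> int \<Rightarrow> (nat \<Rightarrow> 'a \<Rightarrow> int) \<Rightarrow> bool" where
  "rw_in_env M \<omega> x S \<longleftrightarrow>
     (\<forall>n. S n \<in> measurable M (count_space UNIV)) \<and>
     \<P>(w in M. S 0 w = x) = 1 \<and>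
     (\<forall>n s z. \<P>(w in M. \<forall>k\<le>n. S k w = s k) > 0 \<longrightarrow>
        \<P>(w in M. S (Suc n) w = z \<bar> \<forall>k\<le>n. S k w = s k) = step_prob \<omega> (s n) z)"

definition path_space :: "(nat \<Rightarrow> int) measure" where
  "path_space = PiM UNIV (\<lambda>_. count_space UNIV)"

definition walk_labels :: "(int \<times> nat) set" where
  "walk_labels = UNIV \<times> {1..}"

definition all_walks ::
    "(int \<Rightarrow> nat \<Rightarrow> nat \<Rightarrow> 'a \<Rightarrow> int) \<Rightarrow> 'a \<Rightarrow> int \<times> nat \<Rightarrow> nat \<Rightarrow> int" where
  "all_walks X w = (\<lambda>(x, i)\<in>walk_labels. \<lambda>n. X x i n w)"

text \<open>\<open>X x i n\<close> is the position at time \<open>n\<close> of the \<open>i\<close>-th walk started at \<open>x\<close>, where \<open>i \<ge> 1\<close>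
  (\<open>X x 0\<close> is not used). The walks are independent of each other, and the initial configuration
  \<open>\<eta>0\<close> is independent of the whole collection of walks
  (expressed through the generated sigma-algebras, as \<open>indep_var\<close> requires a common value type).\<close>

definition quenched_system ::
    "'a measure \<Rightarrow> (int \<Rightarrow> real) \<Rightarrow> (int \<Rightarrow> nat \<Rightarrow> nat \<Rightarrow> 'a \<Rightarrow> int) \<Rightarrow> ('a \<Rightarrow> int \<Rightarrow> nat) \<Rightarrow> bool"
  where
  "quenched_system M \<omega> X \<eta>0 \<longleftrightarrow>
     prob_space M \<and>
     (\<forall>x. \<forall>i\<ge>1. rw_in_env M \<omega> x (X x i)) \<and>
     prob_space.indep_vars M (\<lambda>_. path_space) (\<lambda>(x, i) w n. X x i n w) walk_labels \<and>
     \<eta>0 \<in> measurable M config_space \<and>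
     prob_space.indep_set M
       {\<eta>0 -` A \<inter> space M | A. A \<in> sets config_space}
       {all_walks X -` B \<inter> space M | B. B \<in> sets (PiM walk_labels (\<lambda>_. path_space))}"

text \<open>The number of particles at \<open>x\<close> at time \<open>n\<close>. Almost surely only the starting points \<open>y\<close> with
  \<open>\<bar>y - x\<bar> \<le> n\<close> contribute, so that the sum over \<open>y\<close> is a finite one; on the exceptional null set
  where infinitely many terms are nonzero, \<open>infsum\<close> returns 0.\<close>

definition particles ::
    "(int \<Rightarrow> nat \<Rightarrow> nat \<Rightarrow> 'a \<Rightarrow> int) \<Rightarrow> ('a \<Rightarrow> int \<Rightarrow> nat) \<Rightarrow> nat \<Rightarrow> 'a \<Rightarrow> int \<Rightarrow> nat" where
  "particles X \<eta>0 n w x =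
     (\<Sum>\<^sub>\<infinity>y. \<Sum>i = 1..\<eta>0 w y. of_bool (X y i n w = x))"

end

theory Submission
  imports Defs
begin

text \<open>The function \<open>x \<mapsto> f(\<theta>\<^sup>x\<omega>)\<close> is an invariant measure of the quenched walk:
  \<open>f(\<theta>\<^sup>x\<omega>) = \<omega>\<^sub>x\<^sub>-\<^sub>1 f(\<theta>\<^sup>x\<^sup>-\<^sup>1\<omega>) + (1 - \<omega>\<^sub>x\<^sub>+\<^sub>1) f(\<theta>\<^sup>x\<^sup>+\<^sup>1\<omega>)\<close>. For finitely many sites
  \<open>J\<close> and \<open>s\<close> equal to 1 off \<open>J\<close>, the product of \<open>s\<^sub>x\<close> to the power \<open>\<eta>\<^sub>n(x)\<close> is the product of
  \<open>s(X\<^sub>n)\<close> over all particles. Averaging over the walks first and then over the independent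
  Poisson variables \<open>\<eta>\<^sub>0(y)\<close> gives the exponential of the sum over \<open>y\<close> of
  \<open>\<alpha> f(\<theta>\<^sup>y\<omega>) (E\<^sub>\<omega> s(X\<^sup>y\<^sub>n) - 1)\<close>. By invariance this does not depend on \<open>n\<close>, and the joint
  generating functions determine the law of the configuration.\<close>

section \<open>The environment\<close>

text \<open>The deterministic condition that carries all quenched arguments. Convergence is required
  at every shift because invariance at one site involves its neighbours; it makes each
  \<open>env_f (shift x \<omega>)\<close> a true series value.\<close>

definition regular_env :: "(int \<Rightarrow> real) \<Rightarrow> bool" where
  "regular_env \<omega> \<longleftrightarrow>
     (\<forall>x. 0 < \<omega> x \<and> \<omega> x \<le> 1 \<and> summable (\<lambda>i. \<Prod>j = 1..Suc i. rho (shift x \<omega>) (int j)))"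

lemma rho_nonneg: "0 \<le> \<omega> x \<Longrightarrow> \<omega> x \<le> 1 \<Longrightarrow> 0 \<le> rho \<omega> x"
  by (simp add: rho_def)

lemma rho_shift: "rho (shift x \<omega>) y = rho \<omega> (x + y)"
  by (simp add: rho_def shift_def)

lemma regular_env_step:
  assumes "regular_env \<omega>"
  shows "0 < \<omega> x" "0 \<le> \<omega> x" "\<omega> x \<le> 1"
  using assms by (auto simp: regular_env_def less_imp_le)

lemma env_f_pos:
  assumes "regular_env \<omega>"
  shows "0 < env_f (shift x \<omega>)"
proof -
  have "0 \<le> (\<Sum>i. \<Prod>j = 1..Suc i. rho (shift x \<omega>) (int j))"
    using assms by (intro suminf_nonneg prod_nonneg)
      (auto simp: regular_env_def shift_def less_imp_le intro!: rho_nonneg)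
  then show ?thesis
    using assms by (auto simp: env_f_def shift_def regular_env_def intro!: divide_pos_pos)
qed

text \<open>The numerator \<open>R\<^sub>x = \<omega>\<^sub>x f(\<theta>\<^sup>x\<omega>)\<close> satisfies \<open>R\<^sub>x = 1 + \<rho>\<^sub>x\<^sub>+\<^sub>1 R\<^sub>x\<^sub>+\<^sub>1\<close>.\<close>

lemma env_f_balance:
  assumes reg: "regular_env \<omega>"
  shows "env_f (shift z \<omega>) = \<omega> (z - 1) * env_f (shift (z - 1) \<omega>)
           + (1 - \<omega> (z + 1)) * env_f (shift (z + 1) \<omega>)"
proof -
  define T where "T x i = (\<Prod>j = 1..Suc i. rho (shift x \<omega>) (int j))" for x i
  define R where "R x = 1 + (\<Sum>i. T x i)" for x
  have pos: "\<omega> x \<noteq> 0" for x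
    using regular_env_step(1)[OF reg, of x] by simp
  have summ: "summable (T x)" for x
    using reg by (simp add: regular_env_def T_def[abs_def])
  have f: "env_f (shift x \<omega>) = R x / \<omega> x" for x
    by (simp add: env_f_def R_def T_def shift_def)
  have T0: "T x 0 = rho \<omega> (x + 1)" for x
    by (simp add: T_def rho_def shift_def)
  \<comment> \<open>The first factor sits at site \<open>x + 1\<close>; the remaining ones form the
    same product based at \<open>x + 1\<close>.\<close>
  have TSuc: "T x (Suc i) = rho \<omega> (x + 1) * T (x + 1) i" for x i
    unfolding T_def
    by (subst prod.atLeast_Suc_atMost, simp, subst One_nat_def, subst prod.atLeast_Suc_atMost_Suc_shift)
      (simp add: rho_def shift_def algebra_simps)
  have R: "R x = 1 + rho \<omega> (x + 1) * R (x + 1)" for x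
  proof -
    have "(\<Sum>i. T x i) = rho \<omega> (x + 1) + (\<Sum>i. rho \<omega> (x + 1) * T (x + 1) i)"
      using suminf_split_head[OF summ[of x]] by (simp add: T0 TSuc)
    also have "\<dots> = rho \<omega> (x + 1) * R (x + 1)"
      using summ by (simp add: suminf_mult R_def algebra_simps)
    finally show ?thesis by (simp add: R_def)
  qed
  \<comment> \<open>In terms of \<open>R\<close> the claim reads
    \<open>R z / \<omega> z = R (z - 1) + (R z - 1)\<close>; the recursion at \<open>z - 1\<close>
    supplies the first term and the recursion at \<open>z\<close> the second.\<close>
  have "R (z - 1) = 1 + (1 - \<omega> z) * R z / \<omega> z"
    using R[of "z - 1"] by (simp add: rho_def)
  moreover have "R z / \<omega> z = R z + (1 - \<omega> z) * R z / \<omega> z"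
    using pos[of z] by (simp add: field_simps)
  moreover have "(1 - \<omega> (z + 1)) * R (z + 1) / \<omega> (z + 1) = R z - 1"
    using R[of z] by (simp add: rho_def)
  ultimately show ?thesis
    using pos[of "z - 1"] by (simp add: f)
qed

text \<open>By independence the product of \<open>i + 1\<close> factors has mean
  \<open>m ^ Suc i\<close> with \<open>m < 1\<close> the mean of \<open>rho\<close>, so the series
  has finite expectation and converges almost surely. Only countably many sites \<open>x\<close> are
  involved.\<close>

lemma AE_regular_env:
  assumes "prob_space P"
    and sets: "sets P = sets env_space"
    and iid: "iid_env P"
    and "c > 0"
    and elliptic: "\<P>(\<omega> in P. \<omega> 0 \<in> {c..1 - c}) = 1"
    and drift: "(\<integral>\<omega>. rho \<omega> 0 \<partial>P) < 1"
  shows "AE \<omega> in P. regular_env \<omega>"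
proof -
  interpret prob_space P by fact
  have indep: "indep_vars (\<lambda>_. borel) (\<lambda>x \<omega>. \<omega> x) (UNIV :: int set)"
    and law: "distr P borel (\<lambda>\<omega>. \<omega> x) = distr P borel (\<lambda>\<omega>. \<omega> 0)" for x
    using iid by (auto simp: iid_env_def)
  have [measurable]: "(\<lambda>\<omega>. \<omega> x) \<in> borel_measurable P" for x
    using indep by (auto simp: indep_vars_def)
  have unit: "0 \<le> \<omega> x \<and> \<omega> x \<le> 1" if "\<omega> \<in> space P" for \<omega> x
    using that by (auto simp: sets_eq_imp_space_eq[OF sets] env_space_def space_PiM)
  have "AE \<omega> in P. \<omega> 0 \<in> {c..1 - c}"
    using AE_prob_1[OF elliptic] by simp
  then have "AE t in distr P borel (\<lambda>\<omega>. \<omega> 0). t \<in> {c..1 - c}"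
    by (subst AE_distr_iff) auto
  then have ell: "AE \<omega> in P. \<omega> x \<in> {c..1 - c}" for x
    by (subst (asm) law[symmetric, of x], subst (asm) AE_distr_iff) auto
  define m where "m = (\<integral>\<omega>. rho \<omega> 0 \<partial>P)"
  \<comment> \<open>A Bochner integral of a non-integrable function is 0, so integrability is what
    turns the drift bound into a bound on the true mean. Ellipticity gives
    \<open>rho \<le> 1 / c\<close>.\<close>
  have "integrable P (\<lambda>\<omega>. rho \<omega> 0)"
  proof (rule integrable_const_bound[where B = "1 / c"])
    show "AE \<omega> in P. norm (rho \<omega> 0) \<le> 1 / c"
      using ell[of 0]
    proof eventually_elim
      case (elim \<omega>)
      then show ?case
        using \<open>c > 0\<close> by (auto simp: rho_def intro!: frac_le)
    qed
  qed (simp add: rho_def)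
  then have m: "(\<integral>\<^sup>+\<omega>. rho \<omega> 0 \<partial>P) = ennreal m"
    unfolding m_def by (intro nn_integral_eq_integral) (auto intro!: rho_nonneg dest: unit)
  have m0: "0 \<le> m" "m < 1"
    using drift unfolding m_def by (auto intro!: Bochner_Integration.integral_nonneg rho_nonneg dest: unit)
  have mean: "(\<integral>\<^sup>+\<omega>. rho \<omega> x \<partial>P) = ennreal m" for x
  proof -
    have "(\<integral>\<^sup>+\<omega>. rho \<omega> y \<partial>P) = (\<integral>\<^sup>+t. ennreal ((1 - t) / t) \<partial>distr P borel (\<lambda>\<omega>. \<omega> y))" for y
      by (subst nn_integral_distr) (auto simp: rho_def)
    then show ?thesis using m law[of x] by simp
  qed
  have prod_mean: "(\<integral>\<^sup>+\<omega>. ennreal (\<Prod>j = 1..Suc i. rho (shift x \<omega>) (int j)) \<partial>P) = ennreal (m ^ Suc i)" for x i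
  proof -
    \<comment> \<open>Reindexing by the sites \<open>x + j\<close> exhibits a product over distinct
      coordinates, the form in which independence applies.\<close>
    have "(\<integral>\<^sup>+\<omega>. ennreal (\<Prod>j = 1..Suc i. rho (shift x \<omega>) (int j)) \<partial>P)
        = (\<integral>\<^sup>+\<omega>. (\<Prod>k\<in>(\<lambda>j. x + int j) ` {1..Suc i}. ennreal (rho \<omega> k)) \<partial>P)"
      by (intro nn_integral_cong, subst prod.reindex)
        (simp_all add: inj_on_def prod_ennreal rho_nonneg rho_shift unit del: prod.cl_ivl_Suc)
    also have "\<dots> = (\<Prod>k\<in>(\<lambda>j. x + int j) ` {1..Suc i}. \<integral>\<^sup>+\<omega>. ennreal (rho \<omega> k) \<partial>P)"
      unfolding rho_def
      by (intro indep_vars_nn_integral indep_vars_compose2[OF indep_vars_subset[OF indep]]) auto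
    also have "\<dots> = ennreal (m ^ Suc i)"
      using m0 by (simp add: mean card_image inj_on_def ennreal_power ennreal_mult')
    finally show ?thesis .
  qed
  have summ: "AE \<omega> in P. summable (\<lambda>i. \<Prod>j = 1..Suc i. rho (shift x \<omega>) (int j))" for x
  proof -
    have [measurable]: "(\<lambda>\<omega>. \<Prod>j = 1..Suc i. rho (shift x \<omega>) (int j)) \<in> borel_measurable P" for i
      unfolding rho_def shift_def by measurable
    have "(\<integral>\<^sup>+\<omega>. (\<Sum>i. ennreal (\<Prod>j = 1..Suc i. rho (shift x \<omega>) (int j))) \<partial>P)
        = (\<Sum>i. \<integral>\<^sup>+\<omega>. ennreal (\<Prod>j = 1..Suc i. rho (shift x \<omega>) (int j)) \<partial>P)"
      by (intro nn_integral_suminf) measurable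
    also have "\<dots> = (\<Sum>i. ennreal (m ^ Suc i))"
      by (simp only: prod_mean)
    also have "\<dots> = ennreal (\<Sum>i. m ^ Suc i)"
      using m0 by (intro suminf_ennreal2) (auto simp del: power_Suc intro!: summable_ignore_initial_segment[where k = 1, simplified] summable_geometric)
    finally have "(\<integral>\<^sup>+\<omega>. (\<Sum>i. ennreal (\<Prod>j = 1..Suc i. rho (shift x \<omega>) (int j))) \<partial>P) \<noteq> \<infinity>"
      by (metis ennreal_neq_top infinity_ennreal_def)
    then have "AE \<omega> in P. (\<Sum>i. ennreal (\<Prod>j = 1..Suc i. rho (shift x \<omega>) (int j))) \<noteq> \<infinity>"
      by (intro nn_integral_PInf_AE) measurable
    then show ?thesis
    proof (rule AE_mp, intro AE_I2 impI)
      fix \<omega> assume "\<omega> \<in> space P" "(\<Sum>i. ennreal (\<Prod>j = 1..Suc i. rho (shift x \<omega>) (int j))) \<noteq> \<infinity>"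
      then show "summable (\<lambda>i. \<Prod>j = 1..Suc i. rho (shift x \<omega>) (int j))"
        by (intro summable_suminf_not_top prod_nonneg) (auto simp: shift_def unit intro!: rho_nonneg)
    qed
  qed
  have "AE \<omega> in P. \<forall>x. \<omega> x \<in> {c..1 - c} \<and> summable (\<lambda>i. \<Prod>j = 1..Suc i. rho (shift x \<omega>) (int j))"
    using ell summ unfolding AE_all_countable by (auto intro: AE_conjI)
  then show ?thesis
  proof eventually_elim
    case (elim \<omega>)
    then have "\<omega> x \<in> {c..1 - c}" for x by blast
    then show ?case
      using elim \<open>c > 0\<close> by (simp add: regular_env_def) (meson diff_le_eq less_le_trans order_trans le_add_same_cancel1 less_imp_le)
  qed
qed

section \<open>The walk in a fixed environment\<close>

text \<open>Transition probabilities by the forward equation: decomposing at the last step keeps the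
  start \<open>y\<close> fixed, which suits both summation over \<open>y\<close> and induction along
  a path.\<close>

primrec walk_prob :: "(int \<Rightarrow> real) \<Rightarrow> nat \<Rightarrow> int \<Rightarrow> int \<Rightarrow> real" where
  "walk_prob \<omega> 0 y z = of_bool (z = y)"
| "walk_prob \<omega> (Suc n) y z =
     walk_prob \<omega> n y (z - 1) * \<omega> (z - 1) + walk_prob \<omega> n y (z + 1) * (1 - \<omega> (z + 1))"

lemma walk_prob_eq_0: "\<bar>z - y\<bar> > int n \<Longrightarrow> walk_prob \<omega> n y z = 0"
  by (induction n arbitrary: z) auto

text \<open>Induction by the forward equation, closed by \<open>env_f_balance\<close> at
  \<open>z\<close>. Any finite \<open>Y\<close> containing the sites within distance
  \<open>n\<close> of \<open>z\<close> is allowed, so that the same \<open>Y\<close> serves for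
  \<open>z - 1\<close> and \<open>z + 1\<close> with one step less.\<close>

lemma walk_prob_invariant:
  assumes reg: "regular_env \<omega>"
  shows "finite Y \<Longrightarrow> {z - int n..z + int n} \<subseteq> Y \<Longrightarrow>
    (\<Sum>y\<in>Y. env_f (shift y \<omega>) * walk_prob \<omega> n y z) = env_f (shift z \<omega>)"
proof (induction n arbitrary: z)
  case 0
  then show ?case by simp
next
  case (Suc n)
  let ?g = "\<lambda>y. env_f (shift y \<omega>)"
  have "(\<Sum>y\<in>Y. ?g y * walk_prob \<omega> (Suc n) y z)
      = \<omega> (z - 1) * (\<Sum>y\<in>Y. ?g y * walk_prob \<omega> n y (z - 1))
        + (1 - \<omega> (z + 1)) * (\<Sum>y\<in>Y. ?g y * walk_prob \<omega> n y (z + 1))"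
    by (simp add: sum_distrib_left sum.distrib algebra_simps sum_subtractf)
  also have "(\<Sum>y\<in>Y. ?g y * walk_prob \<omega> n y (z - 1)) = ?g (z - 1)"
    using Suc.prems by (intro Suc.IH) auto
  also have "(\<Sum>y\<in>Y. ?g y * walk_prob \<omega> n y (z + 1)) = ?g (z + 1)"
    using Suc.prems by (intro Suc.IH) auto
  finally show ?case
    using env_f_balance[OF reg, of z] by simp
qed

section \<open>Marginal law and range of a single walk\<close>

context
  fixes M :: "'a measure" and \<omega> :: "int \<Rightarrow> real" and y :: int and S :: "nat \<Rightarrow> 'a \<Rightarrow> int"
  assumes M: "prob_space M" and reg: "regular_env \<omega>" and rw: "rw_in_env M \<omega> y S"
begin

interpretation prob_space M by fact

lemma rw_measurable: "S n \<in> measurable M (count_space UNIV)"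
  using rw by (simp add: rw_in_env_def)

text \<open>\<open>rw_in_env\<close> fixes the step law only given a whole past of positive
  probability; summing over all pasts that end in \<open>a\<close> leaves conditioning on the
  present alone.\<close>

lemma rw_one_step:
  "\<P>(w in M. S n w = a \<and> S (Suc n) w = z) = \<P>(w in M. S n w = a) * step_prob \<omega> a z"
proof -
  note [measurable] = rw_measurable
  \<comment> \<open>Pasts up to time \<open>n\<close> are encoded as lists of length
    \<open>n + 1\<close>: a countable type, so countable additivity applies.\<close>
  define L where "L = {l :: int list. length l = Suc n \<and> l ! n = a}"
  define C where "C l = {w \<in> space M. \<forall>k\<le>n. S k w = l ! k}" for l
  have C [measurable]: "C l \<in> sets M" for l
    unfolding C_def by measurable
  have disj: "disjoint_family_on C L"
    unfolding disjoint_family_on_def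
  proof (intro ballI impI)
    fix l l' assume "l \<in> L" "l' \<in> L" "l \<noteq> l'"
    then obtain k where "k \<le> n" "l ! k \<noteq> l' ! k"
      by (auto simp: L_def list_eq_iff_nth_eq less_Suc_eq_le)
    then show "C l \<inter> C l' = {}" by (auto simp: C_def)
  qed
  have cover: "{w \<in> space M. S n w = a} = (\<Union>l\<in>L. C l)"
  proof (intro equalityI subsetI)
    fix w assume w: "w \<in> {w \<in> space M. S n w = a}"
    then have "map (\<lambda>k. S k w) [0..<Suc n] \<in> L"
      by (simp add: L_def nth_append)
    moreover have "w \<in> C (map (\<lambda>k. S k w) [0..<Suc n])"
      using w by (auto simp: C_def less_Suc_eq_le simp del: upt_Suc)
    ultimately show "w \<in> (\<Union>l\<in>L. C l)" by blast
  qed (auto simp: C_def L_def)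
  have nonneg: "0 \<le> step_prob \<omega> a z"
    using regular_env_step[OF reg] by (auto simp: step_prob_def)
  have step: "emeasure M (C l \<inter> {w \<in> space M. S (Suc n) w = z}) = emeasure M (C l) * ennreal (step_prob \<omega> a z)"
    if "l \<in> L" for l
  \<comment> \<open>For a null past the conditional law is unspecified, but both sides are
    0.\<close>
  proof (cases "prob (C l) = 0")
    case True
    then show ?thesis
      using finite_measure_mono[OF Int_lower1 C, of l "{w \<in> space M. S (Suc n) w = z}"]
      by (simp add: emeasure_eq_measure measure_le_0_iff)
  next
    case False
    then have "prob (C l) > 0" by (simp add: zero_less_measure_iff)
    then have "\<P>(w in M. S (Suc n) w = z \<bar> \<forall>k\<le>n. S k w = l ! k) = step_prob \<omega> (l ! n) z"
      using rw by (simp add: rw_in_env_def C_def)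
    moreover have "{w \<in> space M. S (Suc n) w = z \<and> (\<forall>k\<le>n. S k w = l ! k)}
        = C l \<inter> {w \<in> space M. S (Suc n) w = z}"
      by (auto simp: C_def)
    ultimately have "prob (C l \<inter> {w \<in> space M. S (Suc n) w = z}) = prob (C l) * step_prob \<omega> a z"
      using False that by (simp add: cond_prob_def C_def[symmetric] L_def field_simps)
    then show ?thesis
      using nonneg by (simp add: emeasure_eq_measure ennreal_mult)
  qed
  have "{w \<in> space M. S n w = a \<and> S (Suc n) w = z}
      = (\<Union>l\<in>L. C l \<inter> {w \<in> space M. S (Suc n) w = z})"
    using cover by blast
  \<comment> \<open>The countable sum over pasts is written as an integral over
    \<open>count_space L\<close>.\<close>
  then have "emeasure M {w \<in> space M. S n w = a \<and> S (Suc n) w = z}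
      = (\<integral>\<^sup>+l. emeasure M (C l \<inter> {w \<in> space M. S (Suc n) w = z}) \<partial>count_space L)"
    using disj by (simp only:, intro emeasure_UN_countable) (auto simp: disjoint_family_on_def)
  also have "\<dots> = (\<integral>\<^sup>+l. emeasure M (C l) * ennreal (step_prob \<omega> a z) \<partial>count_space L)"
    by (intro nn_integral_cong) (simp add: step)
  also have "\<dots> = (\<integral>\<^sup>+l. emeasure M (C l) \<partial>count_space L) * ennreal (step_prob \<omega> a z)"
    by (intro nn_integral_multc) auto
  also have "(\<integral>\<^sup>+l. emeasure M (C l) \<partial>count_space L) = emeasure M {w \<in> space M. S n w = a}"
    unfolding cover using disj by (intro emeasure_UN_countable[symmetric]) auto
  finally show ?thesis
    using nonneg by (simp add: emeasure_eq_measure ennreal_mult'[symmetric])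
qed

lemma rw_marginal: "\<P>(w in M. S n w = z) = walk_prob \<omega> n y z"
proof (induction n arbitrary: z)
  case 0
  have start: "AE w in M. S 0 w = y"
    using rw AE_prob_1[of "{w \<in> space M. S 0 w = y}"] by (simp add: rw_in_env_def)
  have [measurable]: "S 0 \<in> measurable M (count_space UNIV)" by (rule rw_measurable)
  have "\<P>(w in M. S 0 w = z) = \<P>(w in M. y = z)"
    using start by (intro prob_eq_AE) auto
  then show ?case by (auto simp: prob_space)
next
  case (Suc n)
  note [measurable] = rw_measurable
  define E where "E a = {w \<in> space M. S n w = a \<and> S (Suc n) w = z}" for a
  have E [measurable]: "E a \<in> sets M" for a
    unfolding E_def by measurable
  have PE: "prob (E a) = walk_prob \<omega> n y a * step_prob \<omega> a z" for a
    unfolding E_def by (subst rw_one_step) (simp add: Suc.IH)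
  \<comment> \<open>Jumps into \<open>z\<close> from any site other than \<open>z - 1\<close> and
    \<open>z + 1\<close> are null events, and there are countably many of them.\<close>
  have "AE w in M. \<forall>a. a \<noteq> z - 1 \<and> a \<noteq> z + 1 \<longrightarrow> w \<notin> E a"
    unfolding AE_all_countable
  proof
    fix a
    show "AE w in M. a \<noteq> z - 1 \<and> a \<noteq> z + 1 \<longrightarrow> w \<notin> E a"
    proof (cases "a = z - 1 \<or> a = z + 1")
      case False
      then have "prob (E a) = 0"
        by (auto simp: PE step_prob_def)
      then have "AE w in M. w \<notin> E a"
        by (intro AE_not_in) (simp add: null_sets_def emeasure_eq_measure)
      then show ?thesis by eventually_elim simp
    qed auto
  qed
  then have "\<P>(w in M. S (Suc n) w = z) = prob (E (z - 1) \<union> E (z + 1))"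
    by (intro finite_measure_eq_AE, elim AE_mp) (auto simp: E_def intro!: AE_I2)
  also have "\<dots> = prob (E (z - 1)) + prob (E (z + 1))"
    by (intro finite_measure_Union) (auto simp: E_def)
  finally show ?case
    by (simp add: PE step_prob_def)
qed

text \<open>Paths are nearest-neighbour only almost surely, since \<open>rw_in_env\<close>
  constrains probabilities; the countably many unreachable positions each have probability
  0.\<close>

lemma rw_range: "AE w in M. \<bar>S n w - y\<bar> \<le> int n"
proof -
  note [measurable] = rw_measurable
  have "AE w in M. \<forall>z. \<bar>z - y\<bar> > int n \<longrightarrow> S n w \<noteq> z"
    unfolding AE_all_countable
  proof
    fix z
    show "AE w in M. \<bar>z - y\<bar> > int n \<longrightarrow> S n w \<noteq> z"
    proof (cases "\<bar>z - y\<bar> > int n")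
      case True
      then have "\<P>(w in M. S n w = z) = 0"
        by (simp add: rw_marginal walk_prob_eq_0)
      then show ?thesis
        by (subst (asm) prob_eq_0) auto
    qed simp
  qed
  then show ?thesis by eventually_elim (auto simp: not_less[symmetric])
qed

text \<open>As \<open>1 - s\<close> vanishes off \<open>F\<close>, writing \<open>s\<close> as 1
  minus a finite combination of indicators reduces the mean to \<open>walk_prob\<close>. The second
  claim lets this mean serve as the argument of a Poisson generating function.\<close>

lemma rw_expectation:
  assumes "finite F" "\<And>z. z \<in> F \<Longrightarrow> 0 \<le> s z \<and> s z \<le> 1" "\<And>z. z \<notin> F \<Longrightarrow> s z = 1"
  shows "(\<integral>\<^sup>+w. ennreal (s (S n w)) \<partial>M) = ennreal (1 - (\<Sum>z\<in>F. (1 - s z) * walk_prob \<omega> n y z))"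
    and "0 \<le> 1 - (\<Sum>z\<in>F. (1 - s z) * walk_prob \<omega> n y z)"
proof -
  note [measurable] = rw_measurable
  have s01: "0 \<le> s z" "s z \<le> 1" for z
    using assms(2)[of z] assms(3)[of z] by (cases "z \<in> F"; simp)+
  have "s (S n w) = 1 - (\<Sum>z\<in>F. (1 - s z) * indicator {w \<in> space M. S n w = z} w)"
    if "w \<in> space M" for w
  proof -
    have "(\<Sum>z\<in>F. (1 - s z) * indicator {w \<in> space M. S n w = z} w)
        = (\<Sum>z\<in>F. if z = S n w then 1 - s z else 0)"
      using that by (intro sum.cong) (auto simp: indicator_def)
    then show ?thesis using assms by simp
  qed
  then have "(\<integral>w. s (S n w) \<partial>M)
      = (\<integral>w. 1 - (\<Sum>z\<in>F. (1 - s z) * indicator {w \<in> space M. S n w = z} w) \<partial>M)"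
    by (intro Bochner_Integration.integral_cong) auto
  also have "\<dots> = 1 - (\<Sum>z\<in>F. (1 - s z) * walk_prob \<omega> n y z)"
    by (subst Bochner_Integration.integral_diff)
      (auto simp: prob_space rw_marginal Bochner_Integration.integral_sum emeasure_eq_measure)
  finally have eq: "(\<integral>w. s (S n w) \<partial>M) = 1 - (\<Sum>z\<in>F. (1 - s z) * walk_prob \<omega> n y z)" .
  show "0 \<le> 1 - (\<Sum>z\<in>F. (1 - s z) * walk_prob \<omega> n y z)"
    unfolding eq[symmetric] using s01 by (intro Bochner_Integration.integral_nonneg) auto
  have "integrable M (\<lambda>w. s (S n w))"
    using s01 by (intro integrable_const_bound[where B = 1]) auto
  then show "(\<integral>\<^sup>+w. ennreal (s (S n w)) \<partial>M) = ennreal (1 - (\<Sum>z\<in>F. (1 - s z) * walk_prob \<omega> n y z))"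
    unfolding eq[symmetric] using s01 by (intro nn_integral_eq_integral) auto
qed

end

section \<open>Generating functions\<close>

text \<open>Once the coefficients below \<open>m\<close> vanish, division by \<open>s ^ m\<close>
  leaves \<open>d m\<close> plus a tail of size at most \<open>s * D\<close>, with \<open>D\<close>
  independent of \<open>s\<close>; then \<open>s\<close> tends to 0 from the right.\<close>

lemma power_series_coeff_eq_0:
  fixes d :: "nat \<Rightarrow> real"
  assumes abs: "summable (\<lambda>k. \<bar>d k\<bar>)"
    and zero: "\<And>s. 0 < s \<Longrightarrow> s < 1 \<Longrightarrow> (\<Sum>k. d k * s ^ k) = 0"
  shows "d k = 0"
proof (induction k rule: less_induct)
  case (less m)
  define D where "D = (\<Sum>k. \<bar>d k\<bar>)"
  have "\<bar>d m\<bar> \<le> s * D" if s: "0 < s" "s < 1" for s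
  proof -
    have pow: "\<bar>d k * s ^ j\<bar> \<le> \<bar>d k\<bar>" for k j
      using s by (simp add: abs_mult mult_left_le power_le_one)
    have summ: "summable (\<lambda>k. d k * s ^ k)"
      using pow by (intro summable_comparison_test'[OF abs]) auto
    have summ': "summable (\<lambda>k. d (k + Suc m) * s ^ k)"
      by (rule summable_comparison_test'[OF summable_ignore_initial_segment[OF abs, of "Suc m"]])
        (use pow in auto)
    have "(\<Sum>k. d k * s ^ k) = (\<Sum>k. d (k + Suc m) * s ^ (k + Suc m)) + (\<Sum>k<Suc m. d k * s ^ k)"
      by (rule suminf_split_initial_segment[OF summ])
    also have "(\<Sum>k<Suc m. d k * s ^ k) = d m * s ^ m"
      using less by simp
    also have "(\<Sum>k. d (k + Suc m) * s ^ (k + Suc m)) = s ^ m * (s * (\<Sum>k. d (k + Suc m) * s ^ k))"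
      using summ' by (simp add: suminf_mult[symmetric] summable_mult power_add mult_ac)
    finally have "s ^ m * (d m + s * (\<Sum>k. d (k + Suc m) * s ^ k)) = 0"
      using zero[OF s] by (simp add: algebra_simps)
    then have "d m = - (s * (\<Sum>k. d (k + Suc m) * s ^ k))"
      using s by simp
    then have "\<bar>d m\<bar> = s * \<bar>\<Sum>k. d (k + Suc m) * s ^ k\<bar>"
      using s by (simp add: abs_mult)
    also have "\<bar>\<Sum>k. d (k + Suc m) * s ^ k\<bar> \<le> (\<Sum>k. \<bar>d (k + Suc m)\<bar>)"
      by (rule order_trans[OF summable_rabs])
        (auto intro!: suminf_le summable_ignore_initial_segment[OF abs] pow
          summable_comparison_test'[OF summable_ignore_initial_segment[OF abs, of "Suc m"]] simp: pow)
    also have "\<dots> \<le> D"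
      unfolding D_def using suminf_split_initial_segment[OF abs, of "Suc m"] by (simp add: sum_nonneg)
    finally show ?thesis using s by simp
  qed
  then have "\<bar>d m\<bar> \<le> 0"
    by (intro tendsto_lowerbound[of "\<lambda>s. s * D" 0 "at_right 0" "\<bar>d m\<bar>"])
      (auto intro!: tendsto_eq_intros simp: eventually_at_right[of _ 1] intro: exI[of _ 1])
  then show ?case by simp
qed

text \<open>The integrals are power series whose coefficients are the point masses. Finite measures
  are allowed because the lemma is applied to measures with a density, whose total mass is not fixed
  in advance.\<close>

lemma measure_eqI_generating_function:
  fixes \<mu> \<nu> :: "nat measure"
  assumes "finite_measure \<mu>" "finite_measure \<nu>"
    and sets: "sets \<mu> = UNIV" "sets \<nu> = UNIV"
    and eq: "\<And>s. 0 \<le> s \<Longrightarrow> s \<le> 1 \<Longrightarrow> (\<integral>\<^sup>+k. ennreal (s ^ k) \<partial>\<mu>) = (\<integral>\<^sup>+k. ennreal (s ^ k) \<partial>\<nu>)"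
  shows "\<mu> = \<nu>"
proof -
  have gf: "summable (\<lambda>k. measure \<mu> {k})"
    "(\<integral>\<^sup>+k. ennreal (s ^ k) \<partial>\<mu>) = ennreal (\<Sum>k. measure \<mu> {k} * s ^ k)"
    "summable (\<lambda>k. measure \<mu> {k} * s ^ k)"
    if "finite_measure \<mu>" "sets \<mu> = UNIV" "0 \<le> s" "s \<le> 1" for \<mu> :: "nat measure" and s
  proof -
    interpret finite_measure \<mu> by fact
    have sp: "space \<mu> = UNIV"
      using that(2) by (metis sets_eq_imp_space_eq sets_count_space Pow_UNIV space_count_space)
    \<comment> \<open>A measure on \<open>nat\<close> has its point masses as density for counting
      measure, so integrals become series.\<close>
    have dens: "\<mu> = density (count_space UNIV) (\<lambda>k. emeasure \<mu> {k})"
      by (rule measure_eqI) (auto simp: that emeasure_density nn_integral_count_space_indicator[symmetric]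
          intro!: emeasure_countable_singleton)
    have int: "(\<integral>\<^sup>+k. ennreal (f k) \<partial>\<mu>) = (\<Sum>k. ennreal (measure \<mu> {k} * f k))"
      if "\<And>k. 0 \<le> f k" for f
      by (subst dens, subst nn_integral_density)
        (auto simp: nn_integral_count_space_nat emeasure_eq_measure ennreal_mult that)
    have 1: "(\<Sum>k. ennreal (measure \<mu> {k})) \<noteq> top"
    proof -
      have "(\<Sum>k. ennreal (measure \<mu> {k})) = (\<integral>\<^sup>+k. ennreal 1 \<partial>\<mu>)"
        by (subst int) simp_all
      also have "\<dots> = emeasure \<mu> (space \<mu>)"
        by (simp only: nn_integral_const ennreal_1 mult_1)
      finally show ?thesis
        by (metis emeasure_finite infinity_ennreal_def)
    qed
    show *: "summable (\<lambda>k. measure \<mu> {k})"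
      using 1 by (intro summable_suminf_not_top) auto
    show **: "summable (\<lambda>k. measure \<mu> {k} * s ^ k)"
      by (rule summable_comparison_test'[OF *]) (use that in \<open>simp add: abs_mult mult_left_le power_le_one\<close>)
    show "(\<integral>\<^sup>+k. ennreal (s ^ k) \<partial>\<mu>) = ennreal (\<Sum>k. measure \<mu> {k} * s ^ k)"
      using that by (subst int) (auto intro!: suminf_ennreal2 **)
  qed
  note mu = gf[OF assms(1) sets(1)] and nu = gf[OF assms(2) sets(2)]
  have "measure \<mu> {k} - measure \<nu> {k} = 0" for k
  proof (rule power_series_coeff_eq_0[where d = "\<lambda>k. measure \<mu> {k} - measure \<nu> {k}"])
    show "summable (\<lambda>k. \<bar>measure \<mu> {k} - measure \<nu> {k}\<bar>)"
      by (rule summable_comparison_test'[OF summable_add[OF mu(1)[of 1] nu(1)[of 1]]])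
        (auto intro!: order_trans[OF abs_triangle_ineq4])
  next
    fix s :: real assume s: "0 < s" "s < 1"
    then have "ennreal (\<Sum>k. measure \<mu> {k} * s ^ k) = ennreal (\<Sum>k. measure \<nu> {k} * s ^ k)"
      using eq[of s] mu(2)[of s] nu(2)[of s] by simp
    then have "(\<Sum>k. measure \<mu> {k} * s ^ k) = (\<Sum>k. measure \<nu> {k} * s ^ k)"
      using s mu(3)[of s] nu(3)[of s] by (subst (asm) ennreal_inj) (auto intro!: suminf_nonneg)
    then show "(\<Sum>k. (measure \<mu> {k} - measure \<nu> {k}) * s ^ k) = 0"
      using mu(3)[of s] nu(3)[of s] s by (simp add: left_diff_distrib suminf_diff[symmetric])
  qed
  then have "emeasure \<mu> {k} = emeasure \<nu> {k}" for k
    using assms(1,2) by (simp add: finite_measure.emeasure_eq_measure)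
  then show ?thesis
    using sets by (intro measure_eqI_countable[where A = UNIV]) auto
qed

text \<open>The power functions in the hypothesis are replaced by arbitrary functions one coordinate at a time:
  with all other factors frozen, either side is an integral against a finite measure on \<open>nat\<close>.\<close>

lemma config_eqI_generating_function:
  fixes \<mu> \<nu> :: "(int \<Rightarrow> nat) measure"
  assumes "finite_measure \<mu>" "finite_measure \<nu>"
    and sets: "sets \<mu> = sets config_space" "sets \<nu> = sets config_space"
    and eq: "\<And>J s. finite J \<Longrightarrow> (\<And>x. 0 \<le> s x \<and> s x \<le> 1) \<Longrightarrow>
      (\<integral>\<^sup>+\<eta>. (\<Prod>x\<in>J. ennreal (s x ^ \<eta> x)) \<partial>\<mu>) = (\<integral>\<^sup>+\<eta>. (\<Prod>x\<in>J. ennreal (s x ^ \<eta> x)) \<partial>\<nu>)"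
  shows "\<mu> = \<nu>"
proof -
  have coord: "(\<lambda>\<eta>. \<eta> x) \<in> measurable \<mu> (count_space UNIV)" "(\<lambda>\<eta>. \<eta> x) \<in> measurable \<nu> (count_space UNIV)" for x
    by (simp_all add: measurable_cong_sets[OF sets(1) refl] measurable_cong_sets[OF sets(2) refl] config_space_def)
  note [measurable] = coord
  \<comment> \<open>Interpolation between the hypothesis (\<open>G\<close> empty) and equality on
    cylinders (\<open>G = J\<close>): coordinates in \<open>G\<close> carry indicators, the others
    still carry powers.\<close>
  have gen: "(\<integral>\<^sup>+\<eta>. (\<Prod>x\<in>G. indicator (A x) (\<eta> x)) * (\<Prod>x\<in>J - G. ennreal (s x ^ \<eta> x)) \<partial>\<mu>)
      = (\<integral>\<^sup>+\<eta>. (\<Prod>x\<in>G. indicator (A x) (\<eta> x)) * (\<Prod>x\<in>J - G. ennreal (s x ^ \<eta> x)) \<partial>\<nu>)"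
    if "finite J" "G \<subseteq> J" "\<And>x. 0 \<le> s x \<and> s x \<le> 1" for J G A s
  proof -
    have "finite G" using that by (blast intro: finite_subset)
    from this that(2,3) show ?thesis
    proof (induction G arbitrary: s)
      case empty
      then show ?case using eq \<open>finite J\<close> by simp
    next
      case (insert z G)
      define H :: "(int \<Rightarrow> nat) \<Rightarrow> ennreal" where
        "H \<eta> = (\<Prod>x\<in>G. indicator (A x) (\<eta> x)) * (\<Prod>x\<in>J - insert z G. ennreal (s x ^ \<eta> x))" for \<eta>
      have H1: "H \<eta> \<le> 1" for \<eta>
        unfolding H_def using insert.prems
        by (intro mult_le_one prod_le_1) (auto simp: indicator_def power_le_one)
      define L where "L \<mu> = distr (density \<mu> H) (count_space UNIV) (\<lambda>\<eta>. \<eta> z)" for \<mu> :: "(int \<Rightarrow> nat) measure"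
      have L: "(\<integral>\<^sup>+k. h k \<partial>L \<mu>') = (\<integral>\<^sup>+\<eta>. H \<eta> * h (\<eta> z) \<partial>\<mu>')" "finite_measure (L \<mu>')"
        if "\<mu>' \<in> {\<mu>, \<nu>}" for h \<mu>'
      proof -
        have [measurable]: "(\<lambda>\<eta>. \<eta> x) \<in> measurable \<mu>' (count_space UNIV)" for x
          using that coord by auto
        have [measurable]: "H \<in> borel_measurable \<mu>'"
          unfolding H_def by measurable
        show L: "(\<integral>\<^sup>+k. h k \<partial>L \<mu>') = (\<integral>\<^sup>+\<eta>. H \<eta> * h (\<eta> z) \<partial>\<mu>')" for h
        proof -
          have "(\<integral>\<^sup>+k. h k \<partial>L \<mu>') = (\<integral>\<^sup>+\<eta>. h (\<eta> z) \<partial>density \<mu>' H)"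
            unfolding L_def by (rule nn_integral_distr) simp_all
          also have "\<dots> = (\<integral>\<^sup>+\<eta>. H \<eta> * h (\<eta> z) \<partial>\<mu>')"
            by (rule nn_integral_density) simp_all
          finally show ?thesis .
        qed
        show "finite_measure (L \<mu>')"
        proof
          have "emeasure (L \<mu>') (space (L \<mu>')) = (\<integral>\<^sup>+k. 1 \<partial>L \<mu>')" by simp
          also have "\<dots> \<le> (\<integral>\<^sup>+\<eta>. 1 \<partial>\<mu>')"
            unfolding L by (intro nn_integral_mono) (simp add: H1)
          also have "\<dots> < \<infinity>"
            using that assms(1,2)[THEN finite_measure.emeasure_finite] by (auto simp: less_top)
          finally show "emeasure (L \<mu>') (space (L \<mu>')) \<noteq> \<infinity>" by simp
        qed
      qed
      have "L \<mu> = L \<nu>"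
      proof (rule measure_eqI_generating_function)
        show "finite_measure (L \<mu>)" "finite_measure (L \<nu>)"
          using L(2) by auto
        fix t :: real assume t: "0 \<le> t" "t \<le> 1"
        have split: "J - G = insert z (J - insert z G)"
          using insert by auto
        have "(\<Prod>x\<in>G. indicator (A x) (\<eta> x)) * (\<Prod>x\<in>J - G. ennreal ((s(z := t)) x ^ \<eta> x))
            = H \<eta> * ennreal (t ^ \<eta> z)" for \<eta>
          unfolding split H_def using \<open>finite J\<close> by (subst prod.insert) (auto simp: mult_ac intro!: prod.cong)
        \<comment> \<open>The coordinate \<open>z\<close> still carries a power in the induction
          hypothesis; its base is set to the free parameter \<open>t\<close>.\<close>
        then show "(\<integral>\<^sup>+k. ennreal (t ^ k) \<partial>L \<mu>) = (\<integral>\<^sup>+k. ennreal (t ^ k) \<partial>L \<nu>)"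
          using insert.IH[of "s(z := t)"] insert.prems t by (simp add: L(1))
      qed (simp_all add: L_def)
      then have "(\<integral>\<^sup>+k. indicator (A z) k \<partial>L \<mu>) = (\<integral>\<^sup>+k. indicator (A z) k \<partial>L \<nu>)"
        by simp
      then show ?case
        using insert.hyps by (simp add: L(1) H_def mult_ac)
    qed
  qed
  show ?thesis
  proof (rule measure_eqI_PiM_infinite[where I = UNIV and M = "\<lambda>_. count_space UNIV"])
    fix A :: "int \<Rightarrow> nat set" and J :: "int set"
    assume J: "finite J"
    have emb: "emeasure \<mu>' (prod_emb UNIV (\<lambda>_. count_space UNIV) J (Pi\<^sub>E J A))
        = (\<integral>\<^sup>+\<eta>. (\<Prod>x\<in>J. indicator (A x) (\<eta> x)) \<partial>\<mu>')"
      if \<mu>': "sets \<mu>' = sets config_space" for \<mu>' :: "(int \<Rightarrow> nat) measure"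
    proof -
      have "prod_emb UNIV (\<lambda>_. count_space UNIV) J (Pi\<^sub>E J A) \<in> sets \<mu>'"
        unfolding \<mu>' config_space_def using J by (intro sets_PiM_I) auto
      moreover have "(\<Prod>x\<in>J. indicator (A x) (\<eta> x))
          = (indicator (prod_emb UNIV (\<lambda>_. count_space UNIV) J (Pi\<^sub>E J A)) \<eta> :: ennreal)" for \<eta>
        using J by (auto simp: indicator_def prod_emb_def PiE_iff extensional_def)
      ultimately show ?thesis by simp
    qed
    show "emeasure \<mu> (prod_emb UNIV (\<lambda>_. count_space UNIV) J (Pi\<^sub>E J A))
        = emeasure \<nu> (prod_emb UNIV (\<lambda>_. count_space UNIV) J (Pi\<^sub>E J A))"
      using gen[OF J order_refl, of "\<lambda>_. 1" A] by (simp add: emb[OF sets(1)] emb[OF sets(2)])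
  qed (use assms in \<open>simp_all add: config_space_def\<close>)
qed

section \<open>Generating functions of the Poisson product law\<close>

lemma poisson_generating_function:
  assumes "0 < r" "0 \<le> t"
  shows "(\<integral>\<^sup>+k. ennreal (t ^ k) \<partial>measure_pmf (poisson_pmf r)) = ennreal (exp (r * (t - 1)))"
proof -
  have "(\<lambda>k. (r * t) ^ k / fact k * exp (- r)) sums (exp (r * t) * exp (- r))"
    using exp_converges[of "r * t"] by (intro sums_mult2) (simp add: divide_inverse mult.commute)
  then have sums: "(\<lambda>k. r ^ k / fact k * exp (- r) * t ^ k) sums exp (r * (t - 1))"
    by (simp add: power_mult_distrib exp_add[symmetric] algebra_simps)
  have "(\<integral>\<^sup>+k. ennreal (t ^ k) \<partial>measure_pmf (poisson_pmf r)) = (\<Sum>k. ennreal (r ^ k / fact k * exp (- r) * t ^ k))"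
    unfolding nn_integral_measure_pmf nn_integral_count_space_nat
    using assms by (intro suminf_cong) (simp add: ennreal_mult'[symmetric])
  also have "\<dots> = ennreal (\<Sum>k. r ^ k / fact k * exp (- r) * t ^ k)"
    using assms sums by (intro suminf_ennreal2) (auto simp: sums_iff)
  finally show ?thesis
    using sums by (simp add: sums_iff)
qed

lemma prob_space_config_law: "prob_space (config_law \<alpha> \<omega>)"
  unfolding config_law_def by (intro prob_space_PiM prob_space_measure_pmf)

lemma sets_config_law: "sets (config_law \<alpha> \<omega>) = sets config_space"
  unfolding config_law_def config_space_def by (intro sets_PiM_cong) auto

lemma config_law_generating_function:
  assumes reg: "regular_env \<omega>" and "0 < \<alpha>" and "finite Y" and t: "\<And>y. 0 \<le> t y"
  shows "(\<integral>\<^sup>+\<eta>. (\<Prod>y\<in>Y. ennreal (t y ^ \<eta> y)) \<partial>config_law \<alpha> \<omega>)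
    = ennreal (exp (\<alpha> * (\<Sum>y\<in>Y. env_f (shift y \<omega>) * (t y - 1))))"
proof -
  let ?D = "\<lambda>x. measure_pmf (site_law \<alpha> (shift x \<omega>))"
  interpret product_prob_space ?D UNIV
    by unfold_locales
  interpret prob_space "config_law \<alpha> \<omega>"
    by (rule prob_space_config_law)
  have coord: "(\<lambda>\<eta>. \<eta> y) \<in> measurable (config_law \<alpha> \<omega>) (?D y)" for y
    unfolding config_law_def by (intro measurable_component_singleton) simp
  have law: "distr (config_law \<alpha> \<omega>) (?D y) (\<lambda>\<eta>. \<eta> y) = ?D y" for y
    unfolding config_law_def by (intro PiM_component) simp
  \<comment> \<open>Independence of the coordinates: the identity has the product measure as its
    law, and the marginals are the factors.\<close>
  have indep: "indep_vars ?D (\<lambda>y \<eta>. \<eta> y) UNIV"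
  proof (subst indep_vars_iff_distr_eq_PiM)
    have "distr (config_law \<alpha> \<omega>) (config_law \<alpha> \<omega>) (\<lambda>\<eta>. \<eta>) = config_law \<alpha> \<omega>"
      by (rule distr_id)
    moreover have "PiM UNIV ?D = config_law \<alpha> \<omega>"
      by (simp add: config_law_def)
    ultimately show "distr (config_law \<alpha> \<omega>) (PiM UNIV ?D) (\<lambda>\<eta>. \<lambda>y\<in>UNIV. \<eta> y)
        = (\<Pi>\<^sub>M y\<in>UNIV. distr (config_law \<alpha> \<omega>) (?D y) (\<lambda>\<eta>. \<eta> y))"
      by (simp add: law restrict_UNIV)
  qed (simp, rule coord)
  have "(\<integral>\<^sup>+\<eta>. (\<Prod>y\<in>Y. ennreal (t y ^ \<eta> y)) \<partial>config_law \<alpha> \<omega>)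
      = (\<Prod>y\<in>Y. \<integral>\<^sup>+\<eta>. ennreal (t y ^ \<eta> y) \<partial>config_law \<alpha> \<omega>)"
    using \<open>finite Y\<close>
    by (intro indep_vars_nn_integral indep_vars_compose2[OF indep_vars_subset[OF indep]]) auto
  also have "\<dots> = (\<Prod>y\<in>Y. \<integral>\<^sup>+k. ennreal (t y ^ k) \<partial>?D y)"
  proof (intro prod.cong refl)
    fix y
    have "(\<integral>\<^sup>+k. ennreal (t y ^ k) \<partial>?D y)
        = (\<integral>\<^sup>+k. ennreal (t y ^ k) \<partial>distr (config_law \<alpha> \<omega>) (?D y) (\<lambda>\<eta>. \<eta> y))"
      by (simp only: law)
    also have "\<dots> = (\<integral>\<^sup>+\<eta>. ennreal (t y ^ \<eta> y) \<partial>config_law \<alpha> \<omega>)"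
      by (rule nn_integral_distr[OF coord]) simp
    finally show "(\<integral>\<^sup>+\<eta>. ennreal (t y ^ \<eta> y) \<partial>config_law \<alpha> \<omega>) = (\<integral>\<^sup>+k. ennreal (t y ^ k) \<partial>?D y)" ..
  qed
  also have "\<dots> = (\<Prod>y\<in>Y. ennreal (exp (\<alpha> * env_f (shift y \<omega>) * (t y - 1))))"
    unfolding site_law_def
    using env_f_pos[OF reg] \<open>0 < \<alpha>\<close> t by (intro prod.cong refl poisson_generating_function) auto
  also have "\<dots> = ennreal (exp (\<alpha> * (\<Sum>y\<in>Y. env_f (shift y \<omega>) * (t y - 1))))"
    using \<open>finite Y\<close> by (simp add: prod_ennreal exp_sum sum_distrib_left mult.assoc)
  finally show ?thesis .
qed

text \<open>The joint law is a product, so Tonelli lets the second variable be averaged with the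
  first held fixed. Independence is stated through generated sigma-algebras to match
  \<open>quenched_system\<close>, where the two value types differ.\<close>

lemma (in prob_space) nn_integral_indep_pair:
  assumes [measurable]: "X \<in> measurable M N" "Y \<in> measurable M L"
    and indep: "indep_set {X -` A \<inter> space M | A. A \<in> sets N} {Y -` B \<inter> space M | B. B \<in> sets L}"
    and h [measurable]: "h \<in> borel_measurable (N \<Otimes>\<^sub>M L)"
  shows "(\<integral>\<^sup>+w. h (X w, Y w) \<partial>M) = (\<integral>\<^sup>+w. \<integral>\<^sup>+w'. h (X w, Y w') \<partial>M \<partial>M)"
proof -
  interpret X: prob_space "distr M N X" by (rule prob_space_distr) simp
  interpret Y: prob_space "distr M L Y" by (rule prob_space_distr) simp
  have joint: "distr M N X \<Otimes>\<^sub>M distr M L Y = distr M (N \<Otimes>\<^sub>M L) (\<lambda>w. (X w, Y w))"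
  proof (rule pair_measure_eqI)
    fix A B assume "A \<in> sets (distr M N X)" "B \<in> sets (distr M L Y)"
    then have AB [measurable]: "A \<in> sets N" "B \<in> sets L" by simp_all
    have "prob ((X -` A \<inter> space M) \<inter> (Y -` B \<inter> space M))
        = prob (X -` A \<inter> space M) * prob (Y -` B \<inter> space M)"
      using AB by (intro indep_setD[OF indep]) blast+
    moreover have "(\<lambda>w. (X w, Y w)) -` (A \<times> B) \<inter> space M = (X -` A \<inter> space M) \<inter> (Y -` B \<inter> space M)"
      by auto
    ultimately show "emeasure (distr M N X) A * emeasure (distr M L Y) B
        = emeasure (distr M (N \<Otimes>\<^sub>M L) (\<lambda>w. (X w, Y w))) (A \<times> B)"
      by (simp add: emeasure_distr emeasure_eq_measure ennreal_mult)
  next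
    show "sets (distr M N X \<Otimes>\<^sub>M distr M L Y) = sets (distr M (N \<Otimes>\<^sub>M L) (\<lambda>w. (X w, Y w)))"
      by (simp cong: sets_pair_measure_cong)
  qed (rule X.sigma_finite_measure_axioms Y.sigma_finite_measure_axioms)+
  have "(\<integral>\<^sup>+w. h (X w, Y w) \<partial>M) = (\<integral>\<^sup>+p. h p \<partial>distr M (N \<Otimes>\<^sub>M L) (\<lambda>w. (X w, Y w)))"
    by (subst nn_integral_distr) auto
  also have "\<dots> = (\<integral>\<^sup>+x. \<integral>\<^sup>+y. h (x, y) \<partial>distr M L Y \<partial>distr M N X)"
    unfolding joint[symmetric] by (subst Y.nn_integral_fst[symmetric]) simp_all
  also have "\<dots> = (\<integral>\<^sup>+w. \<integral>\<^sup>+y. h (X w, y) \<partial>distr M L Y \<partial>M)"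
    by (subst nn_integral_distr) (auto intro: Y.borel_measurable_nn_integral_fst)
  also have "\<dots> = (\<integral>\<^sup>+w. \<integral>\<^sup>+w'. h (X w, Y w') \<partial>M \<partial>M)"
    by (intro nn_integral_cong nn_integral_distr) (auto dest: measurable_space[OF assms(1)])
  finally show ?thesis .
qed

section \<open>The particle system\<close>

text \<open>Convergence in the discrete space \<open>nat\<close> means that the finite partial sums
  are eventually constant, so adding one more point to a large enough set contributes 0.\<close>

lemma summable_on_nat_finite_support:
  fixes g :: "'b \<Rightarrow> nat"
  assumes "g summable_on UNIV"
  shows "finite {y. g y \<noteq> 0}"
proof -
  obtain l where "(g has_sum l) UNIV"
    using assms by (auto simp: summable_on_def)
  then have "\<forall>\<^sub>F F in finite_subsets_at_top UNIV. sum g F = l"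
    unfolding has_sum_def tendsto_discrete .
  then obtain F0 where F0: "finite F0" "\<And>F. finite F \<Longrightarrow> F0 \<subseteq> F \<Longrightarrow> sum g F = l"
    by (auto simp: eventually_finite_subsets_at_top)
  have "y \<in> F0" if "g y \<noteq> 0" for y
    using F0(2)[OF F0(1) order_refl] F0(2)[of "insert y F0"] F0(1) that by (cases "y \<in> F0") auto
  then show ?thesis
    by (intro finite_subset[OF _ F0(1)] subsetI) simp
qed

text \<open>Either the support lies in some interval from \<open>-N\<close> to \<open>N\<close>, and
  the sum is finite with the least such \<open>N\<close>, or it is infinite and
  \<open>infsum\<close> takes its default 0. Both cases are measurable.\<close>

lemma measurable_infsum_nat:
  fixes f :: "'a \<Rightarrow> int \<Rightarrow> nat"
  assumes [measurable]: "\<And>y. (\<lambda>w. f w y) \<in> measurable M (count_space UNIV)"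
  shows "(\<lambda>w. \<Sum>\<^sub>\<infinity>y. f w y) \<in> measurable M (count_space UNIV)"
proof -
  define B where "B w N \<longleftrightarrow> (\<forall>y. \<bar>y\<bar> > int N \<longrightarrow> f w y = 0)" for w and N :: nat
  have [measurable]: "Measurable.pred M (\<lambda>w. B w N)" for N
    unfolding B_def by measurable
  have eq: "(\<Sum>\<^sub>\<infinity>y. f w y) = (if \<exists>N. B w N then \<Sum>y\<in>{- int (LEAST N. B w N)..int (LEAST N. B w N)}. f w y else 0)" for w
  proof (cases "\<exists>N. B w N")
    case True
    define N where "N = (LEAST N. B w N)"
    have "B w N" unfolding N_def using True by (rule LeastI_ex)
    then have zero: "f w y = 0" if "y \<notin> {- int N..int N}" for y
      using that unfolding B_def by (metis abs_le_iff atLeastAtMost_iff minus_le_iff not_le)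
    have "(\<Sum>\<^sub>\<infinity>y. f w y) = (\<Sum>\<^sub>\<infinity>y\<in>{- int N..int N}. f w y)"
      by (rule infsum_cong_neutral) (use zero in blast)+
    then show ?thesis using True by (simp add: N_def)
  next
    case False
    have "\<not> f w summable_on UNIV"
    proof
      assume "f w summable_on UNIV"
      then have fin: "finite {y. f w y \<noteq> 0}" by (rule summable_on_nat_finite_support)
      \<comment> \<open>The inserted 0 keeps \<open>Max\<close> meaningful when the support is
        empty.\<close>
      have "B w (Max (insert 0 ((\<lambda>y. nat \<bar>y\<bar>) ` {y. f w y \<noteq> 0})))"
        unfolding B_def
      proof (intro allI impI, rule ccontr)
        fix y assume y: "\<bar>y\<bar> > int (Max (insert 0 ((\<lambda>y. nat \<bar>y\<bar>) ` {y. f w y \<noteq> 0})))" "f w y \<noteq> 0"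
        then have "nat \<bar>y\<bar> \<le> Max (insert 0 ((\<lambda>y. nat \<bar>y\<bar>) ` {y. f w y \<noteq> 0}))"
          using fin by (intro Max_ge) auto
        with y(1) show False by linarith
      qed
      then show False using False by blast
    qed
    then show ?thesis using False by (simp add: infsum_not_exists)
  qed
  have [measurable]: "(\<lambda>w. LEAST N. B w N) \<in> measurable M (count_space UNIV)"
    by measurable
  have "(\<lambda>w. \<Sum>y\<in>{- int (LEAST N. B w N)..int (LEAST N. B w N)}. f w y) \<in> measurable M (count_space UNIV)"
    by (rule measurable_compose_countable[where f = "\<lambda>N w. \<Sum>y\<in>{- int N..int N}. f w y" and g = "\<lambda>w. LEAST N. B w N"]) measurable
  moreover have "{w \<in> space M. \<exists>N. B w N} \<in> sets M"
    by measurable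
  ultimately have "(\<lambda>w. if \<exists>N. B w N
      then \<Sum>y\<in>{- int (LEAST N. B w N)..int (LEAST N. B w N)}. f w y else 0) \<in> measurable M (count_space UNIV)"
    by (intro measurable_If measurable_const) simp_all
  then show ?thesis
    by (simp only: eq)
qed

lemma generating_monomial_measurable:
  "(\<lambda>\<eta>. \<Prod>x\<in>J. ennreal (s x ^ \<eta> x)) \<in> borel_measurable config_space"
proof (rule borel_measurable_prod_ennreal)
  fix x
  have "(\<lambda>\<eta>. \<eta> x) \<in> measurable config_space (count_space UNIV)"
    unfolding config_space_def by (rule measurable_component_singleton) simp
  then show "(\<lambda>\<eta>. ennreal (s x ^ \<eta> x)) \<in> borel_measurable config_space"
    by (rule measurable_compose) simp
qed

section \<open>Law of the configuration at time \<open>n\<close>\<close>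

context
  fixes M :: "'a measure" and \<omega> :: "int \<Rightarrow> real"
    and X :: "int \<Rightarrow> nat \<Rightarrow> nat \<Rightarrow> 'a \<Rightarrow> int" and \<eta>0 :: "'a \<Rightarrow> int \<Rightarrow> nat"
  assumes sys: "quenched_system M \<omega> X \<eta>0" and reg: "regular_env \<omega>"
begin

interpretation prob_space M
  using sys by (simp add: quenched_system_def)

lemma rw_walks: "1 \<le> i \<Longrightarrow> rw_in_env M \<omega> y (X y i)"
  using sys by (simp add: quenched_system_def)

lemma walk_measurable: "1 \<le> i \<Longrightarrow> X y i n \<in> measurable M (count_space UNIV)"
  using rw_walks by (simp add: rw_in_env_def)

lemma initial_measurable: "\<eta>0 \<in> measurable M config_space"
  using sys by (simp add: quenched_system_def)

lemma initial_coord_measurable: "(\<lambda>w. \<eta>0 w y) \<in> measurable M (count_space UNIV)"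
  using measurable_compose[OF initial_measurable[unfolded config_space_def]
      measurable_component_singleton[of y UNIV]] by simp

lemma all_walks_measurable: "all_walks X \<in> measurable M (PiM walk_labels (\<lambda>_. path_space))"
  unfolding all_walks_def path_space_def case_prod_beta
  by (intro measurable_restrict measurable_PiM_single')
    (auto simp: walk_labels_def walk_measurable)

lemma particles_measurable: "particles X \<eta>0 n \<in> measurable M config_space"
  unfolding config_space_def
proof (rule measurable_PiM_single')
  fix x :: int
  \<comment> \<open>The random upper limit takes countably many values, so it suffices to treat each
    fixed value \<open>k\<close>.\<close>
  have "(\<lambda>w. \<Sum>i = 1..\<eta>0 w y. of_bool (X y i n w = x) :: nat) \<in> measurable M (count_space UNIV)" for y
  proof (rule measurable_compose_countable[OF _ initial_coord_measurable])
    fix k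
    have [measurable]: "X y i n \<in> measurable M (count_space UNIV)" if "i \<in> {1..k}" for i
      using that by (intro walk_measurable) simp
    show "(\<lambda>w. \<Sum>i = 1..k. of_bool (X y i n w = x) :: nat) \<in> measurable M (count_space UNIV)"
      unfolding of_bool_def by measurable
  qed
  then show "(\<lambda>w. particles X \<eta>0 n w x) \<in> measurable M (count_space UNIV)"
    unfolding particles_def by (rule measurable_infsum_nat)
qed auto

lemma AE_walks_range: "AE w in M. \<forall>y. \<forall>i\<ge>1. \<bar>X y i n w - y\<bar> \<le> int n"
  unfolding AE_all_countable
proof (intro allI)
  fix y and i :: nat
  show "AE w in M. 1 \<le> i \<longrightarrow> \<bar>X y i n w - y\<bar> \<le> int n"
    using rw_range[OF prob_space_axioms reg rw_walks, of i y n] by (cases "1 \<le> i") auto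
qed

text \<open>Under the range bound only particles started in \<open>Y\<close> can reach
  \<open>J\<close>, so the infinite sum is finite. Regrouping by particle instead of by site, each
  particle contributes one factor determined by its position.\<close>

lemma particles_generating_function_path:
  fixes s :: "int \<Rightarrow> real"
  assumes "finite J" and range: "\<And>y i. 1 \<le> i \<Longrightarrow> \<bar>X y i n w - y\<bar> \<le> int n"
    and Y: "finite Y" "\<And>x. x \<in> J \<Longrightarrow> {x - int n..x + int n} \<subseteq> Y"
  shows "(\<Prod>x\<in>J. s x ^ particles X \<eta>0 n w x)
    = (\<Prod>y\<in>Y. \<Prod>i = 1..\<eta>0 w y. if X y i n w \<in> J then s (X y i n w) else 1)"
proof -
  have part: "particles X \<eta>0 n w x = (\<Sum>y\<in>Y. \<Sum>i = 1..\<eta>0 w y. of_bool (X y i n w = x))" if "x \<in> J" for x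
  proof -
    have "(\<Sum>i = 1..\<eta>0 w y. of_bool (X y i n w = x) :: nat) = 0" if "y \<notin> Y" for y
    proof (intro sum.neutral ballI)
      fix i assume "i \<in> {1..\<eta>0 w y}"
      then have "\<bar>X y i n w - y\<bar> \<le> int n" by (intro range) simp
      moreover have "\<not> \<bar>x - y\<bar> \<le> int n"
        using Y(2)[OF \<open>x \<in> J\<close>] \<open>y \<notin> Y\<close> by (auto simp: subset_iff dest!: spec[of _ y])
      ultimately show "of_bool (X y i n w = x) = (0 :: nat)" by auto
    qed
    then have "particles X \<eta>0 n w x = (\<Sum>\<^sub>\<infinity>y\<in>Y. \<Sum>i = 1..\<eta>0 w y. of_bool (X y i n w = x))"
      unfolding particles_def by (intro infsum_cong_neutral) auto
    then show ?thesis using Y(1) by simp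
  qed
  have "(\<Prod>x\<in>J. s x ^ particles X \<eta>0 n w x)
      = (\<Prod>x\<in>J. \<Prod>y\<in>Y. \<Prod>i = 1..\<eta>0 w y. s x ^ of_bool (X y i n w = x))"
    by (intro prod.cong refl) (simp only: part power_sum)
  also have "\<dots> = (\<Prod>y\<in>Y. \<Prod>x\<in>J. \<Prod>i = 1..\<eta>0 w y. s x ^ of_bool (X y i n w = x))"
    by (rule prod.swap)
  also have "\<dots> = (\<Prod>y\<in>Y. \<Prod>i = 1..\<eta>0 w y. \<Prod>x\<in>J. s x ^ of_bool (X y i n w = x))"
    by (intro prod.cong refl prod.swap)
  \<comment> \<open>A particle sits at one site only, so at most one factor of the inner product
    over \<open>J\<close> differs from 1.\<close>
  also have "\<dots> = (\<Prod>y\<in>Y. \<Prod>i = 1..\<eta>0 w y. \<Prod>x\<in>J. if x = X y i n w then s x else 1)"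
    by (intro prod.cong refl) auto
  also have "\<dots> = (\<Prod>y\<in>Y. \<Prod>i = 1..\<eta>0 w y. if X y i n w \<in> J then s (X y i n w) else 1)"
    using \<open>finite J\<close> by (simp add: prod.delta)
  finally show ?thesis .
qed

text \<open>The average over the walks for frozen initial counts \<open>k\<close>: distinct labels
  are independent, and the \<open>k y\<close> walks from \<open>y\<close> share the same
  marginal.\<close>

lemma walks_expectation_prod:
  assumes "finite Y" "finite J" and s: "\<And>z. z \<in> J \<Longrightarrow> 0 \<le> s z \<and> s z \<le> 1" "\<And>z. z \<notin> J \<Longrightarrow> s z = 1"
  shows "(\<integral>\<^sup>+w. (\<Prod>y\<in>Y. \<Prod>i = 1..k y. ennreal (s (X y i n w))) \<partial>M)
    = (\<Prod>y\<in>Y. ennreal ((1 - (\<Sum>z\<in>J. (1 - s z) * walk_prob \<omega> n y z)) ^ k y))"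
proof -
  let ?L = "Sigma Y (\<lambda>y. {1..k y})"
  have L: "finite ?L" "?L \<subseteq> walk_labels"
    using \<open>finite Y\<close> by (auto simp: walk_labels_def)
  have indep: "indep_vars (\<lambda>_. path_space) (\<lambda>p w n. X (fst p) (snd p) n w) walk_labels"
    using sys by (simp add: quenched_system_def case_prod_beta')
  have at_time: "(\<lambda>f. f n) \<in> measurable path_space (count_space UNIV)"
    unfolding path_space_def by (rule measurable_component_singleton) simp
  have "(\<integral>\<^sup>+w. (\<Prod>y\<in>Y. \<Prod>i = 1..k y. ennreal (s (X y i n w))) \<partial>M)
      = (\<integral>\<^sup>+w. (\<Prod>p\<in>?L. ennreal (s (X (fst p) (snd p) n w))) \<partial>M)"
    using \<open>finite Y\<close> by (simp add: prod.Sigma case_prod_beta')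
  also have "\<dots> = (\<Prod>p\<in>?L. \<integral>\<^sup>+w. ennreal (s (X (fst p) (snd p) n w)) \<partial>M)"
    using L(1)
    by (intro indep_vars_nn_integral indep_vars_compose2[OF indep_vars_subset[OF indep L(2)],
          of "\<lambda>_ f. ennreal (s (f n))"] measurable_compose[OF at_time]) auto
  also have "\<dots> = (\<Prod>p\<in>?L. ennreal (1 - (\<Sum>z\<in>J. (1 - s z) * walk_prob \<omega> n (fst p) z)))"
    using rw_expectation(1)[OF prob_space_axioms reg rw_walks \<open>finite J\<close> s]
    by (intro prod.cong refl) auto
  also have "\<dots> = (\<Prod>y\<in>Y. \<Prod>i = 1..k y. ennreal (1 - (\<Sum>z\<in>J. (1 - s z) * walk_prob \<omega> n y z)))"
    using \<open>finite Y\<close> by (subst prod.Sigma) (simp_all add: case_prod_beta')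
  \<comment> \<open>Nonnegativity of the base does not depend on \<open>i\<close>, so the walk with
    index 1 supplies it.\<close>
  also have "\<dots> = (\<Prod>y\<in>Y. ennreal ((1 - (\<Sum>z\<in>J. (1 - s z) * walk_prob \<omega> n y z)) ^ k y))"
    using rw_expectation(2)[OF prob_space_axioms reg rw_walks[OF order_refl] \<open>finite J\<close> s]
    by (simp add: ennreal_power)
  finally show ?thesis .
qed

text \<open>The right-hand side is free of \<open>n\<close> and agrees with
  \<open>config_law_generating_function\<close> for \<open>Y = J\<close> and
  \<open>t = s\<close>.\<close>

lemma particles_generating_function:
  assumes law: "distr M config_space \<eta>0 = config_law \<alpha> \<omega>" and "0 < \<alpha>"
    and "finite J" and s: "\<And>x. 0 \<le> s x \<and> s x \<le> 1"
  shows "(\<integral>\<^sup>+w. (\<Prod>x\<in>J. ennreal (s x ^ particles X \<eta>0 n w x)) \<partial>M)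
    = ennreal (exp (\<alpha> * (\<Sum>x\<in>J. env_f (shift x \<omega>) * (s x - 1))))"
proof -
  define Y where "Y = (\<Union>x\<in>J. {x - int n..x + int n})"
  \<comment> \<open>Setting the weight to 1 off \<open>J\<close> makes particles outside
    \<open>J\<close> contribute trivially and fits the hypotheses of
    \<open>rw_expectation\<close>.\<close>
  define s' where "s' z = (if z \<in> J then s z else 1)" for z
  \<comment> \<open>\<open>G y\<close> is the quenched mean of \<open>s'\<close> at the
    time-\<open>n\<close> position of a walk from \<open>y\<close>.\<close>
  define G where "G y = 1 - (\<Sum>z\<in>J. (1 - s' z) * walk_prob \<omega> n y z)" for y
  \<comment> \<open>The product over particles as a function of the pair (initial configuration, all
    walks), ready for the independence argument.\<close>
  define h :: "(int \<Rightarrow> nat) \<times> (int \<times> nat \<Rightarrow> nat \<Rightarrow> int) \<Rightarrow> ennreal" where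
    "h p = (\<Prod>y\<in>Y. \<Prod>i = 1..fst p y. ennreal (s' (snd p (y, i) n)))" for p
  have Y: "finite Y" "\<And>x. x \<in> J \<Longrightarrow> {x - int n..x + int n} \<subseteq> Y"
    using \<open>finite J\<close> by (auto simp: Y_def)
  have s': "\<And>z. z \<in> J \<Longrightarrow> 0 \<le> s' z \<and> s' z \<le> 1" "\<And>z. z \<notin> J \<Longrightarrow> s' z = 1"
    using s by (auto simp: s'_def)
  have G: "0 \<le> G y" for y
    unfolding G_def by (rule rw_expectation(2)[OF prob_space_axioms reg rw_walks[OF order_refl] \<open>finite J\<close> s'])
  have h_meas: "h \<in> borel_measurable (config_space \<Otimes>\<^sub>M PiM walk_labels (\<lambda>_. path_space))"
    unfolding h_def
  proof (rule borel_measurable_prod_ennreal)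
    fix y
    let ?N = "config_space \<Otimes>\<^sub>M PiM walk_labels (\<lambda>_. path_space)"
    have fst: "(\<lambda>p. fst p y) \<in> measurable ?N (count_space UNIV)"
      unfolding config_space_def
      by (rule measurable_compose[OF measurable_fst measurable_component_singleton]) simp
    have snd: "(\<lambda>p. snd p (y, i) n) \<in> measurable ?N (count_space UNIV)" if "1 \<le> i" for i
    proof -
      have "(\<lambda>p. snd p (y, i)) \<in> measurable ?N path_space"
        using that by (intro measurable_compose[OF measurable_snd measurable_component_singleton])
          (simp add: walk_labels_def)
      then show ?thesis
        unfolding path_space_def by (rule measurable_compose) (rule measurable_component_singleton, simp)
    qed
    show "(\<lambda>p. \<Prod>i = 1..fst p y. ennreal (s' (snd p (y, i) n))) \<in> borel_measurable ?N"
      by (rule measurable_compose_countable[OF _ fst], rule borel_measurable_prod_ennreal,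
          rule measurable_compose[OF snd]) auto
  qed
  have h_walks: "h (\<eta>, all_walks X w) = (\<Prod>y\<in>Y. \<Prod>i = 1..\<eta> y. ennreal (s' (X y i n w)))" for \<eta> w
    unfolding h_def by (intro prod.cong refl) (auto simp: all_walks_def walk_labels_def)
  have "(\<integral>\<^sup>+w. (\<Prod>x\<in>J. ennreal (s x ^ particles X \<eta>0 n w x)) \<partial>M)
      = (\<integral>\<^sup>+w. h (\<eta>0 w, all_walks X w) \<partial>M)"
  proof (rule nn_integral_cong_AE)
    show "AE w in M. (\<Prod>x\<in>J. ennreal (s x ^ particles X \<eta>0 n w x)) = h (\<eta>0 w, all_walks X w)"
      using AE_walks_range[of n]
    proof eventually_elim
      case (elim w)
      have "(\<Prod>x\<in>J. s x ^ particles X \<eta>0 n w x) = (\<Prod>y\<in>Y. \<Prod>i = 1..\<eta>0 w y. s' (X y i n w))"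
        unfolding s'_def using elim by (intro particles_generating_function_path \<open>finite J\<close> Y) auto
      moreover have "0 \<le> s' z" for z
        using s by (simp add: s'_def)
      ultimately show ?case
        using s by (simp add: h_walks prod_ennreal prod_nonneg)
    qed
  qed
  \<comment> \<open>The walks are now evaluated at \<open>w'\<close>, so in the inner integral the
    initial counts are constants.\<close>
  also have "\<dots> = (\<integral>\<^sup>+w. \<integral>\<^sup>+w'. h (\<eta>0 w, all_walks X w') \<partial>M \<partial>M)"
    using sys by (intro nn_integral_indep_pair[OF initial_measurable all_walks_measurable _ h_meas])
      (simp add: quenched_system_def)
  also have "\<dots> = (\<integral>\<^sup>+w. (\<Prod>y\<in>Y. ennreal (G y ^ \<eta>0 w y)) \<partial>M)"
    unfolding h_walks G_def by (subst walks_expectation_prod[OF Y(1) \<open>finite J\<close> s']) simp_all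
  also have "\<dots> = (\<integral>\<^sup>+\<eta>. (\<Prod>y\<in>Y. ennreal (G y ^ \<eta> y)) \<partial>config_law \<alpha> \<omega>)"
    unfolding law[symmetric]
    by (subst nn_integral_distr[OF initial_measurable]) (simp_all add: generating_monomial_measurable)
  also have "\<dots> = ennreal (exp (\<alpha> * (\<Sum>y\<in>Y. env_f (shift y \<omega>) * (G y - 1))))"
    by (rule config_law_generating_function[OF reg \<open>0 < \<alpha>\<close> Y(1) G])
  \<comment> \<open>\<open>G y - 1\<close> is a sum over \<open>z\<close> in \<open>J\<close> of
    \<open>(s z - 1) * walk_prob \<omega> n y z\<close>; after exchanging the sums, invariance of
    \<open>env_f\<close> removes \<open>n\<close>.\<close>
  also have "(\<Sum>y\<in>Y. env_f (shift y \<omega>) * (G y - 1))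
      = (\<Sum>y\<in>Y. \<Sum>z\<in>J. (s z - 1) * (env_f (shift y \<omega>) * walk_prob \<omega> n y z))"
    unfolding G_def by (simp add: s'_def sum_distrib_left sum_negf[symmetric] algebra_simps)
  also have "\<dots> = (\<Sum>z\<in>J. (s z - 1) * (\<Sum>y\<in>Y. env_f (shift y \<omega>) * walk_prob \<omega> n y z))"
    by (subst sum.swap) (simp add: sum_distrib_left)
  also have "\<dots> = (\<Sum>z\<in>J. env_f (shift z \<omega>) * (s z - 1))"
    using Y by (intro sum.cong refl) (simp add: walk_prob_invariant[OF reg])
  finally show ?thesis .
qed

lemma particles_law:
  assumes law: "distr M config_space \<eta>0 = config_law \<alpha> \<omega>" and "0 < \<alpha>"
  shows "distr M config_space (particles X \<eta>0 n) = config_law \<alpha> \<omega>"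
proof (rule config_eqI_generating_function)
  show "finite_measure (distr M config_space (particles X \<eta>0 n))"
    by (intro prob_space.finite_measure prob_space_distr particles_measurable)
  show "finite_measure (config_law \<alpha> \<omega>)"
    by (intro prob_space.finite_measure prob_space_config_law)
  fix J :: "int set" and s :: "int \<Rightarrow> real"
  assume J: "finite J" and s: "\<And>x. 0 \<le> s x \<and> s x \<le> 1"
  show "(\<integral>\<^sup>+\<eta>. (\<Prod>x\<in>J. ennreal (s x ^ \<eta> x)) \<partial>distr M config_space (particles X \<eta>0 n))
      = (\<integral>\<^sup>+\<eta>. (\<Prod>x\<in>J. ennreal (s x ^ \<eta> x)) \<partial>config_law \<alpha> \<omega>)"
    using s by (subst nn_integral_distr[OF particles_measurable])
      (simp_all add: generating_monomial_measurable particles_generating_function[OF law \<open>0 < \<alpha>\<close> J s]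
        config_law_generating_function[OF reg \<open>0 < \<alpha>\<close> J])
qed (simp_all add: sets_config_law)

end

theorem lemma4p3:
  fixes P :: "(int \<Rightarrow> real) measure" and c \<alpha> :: real
  assumes "prob_space P"
    and "sets P = sets env_space"
    and "iid_env P"
    and "c > 0"
    and "\<P>(\<omega> in P. \<omega> 0 \<in> {c..1 - c}) = 1"
    and "(\<integral>\<omega>. rho \<omega> 0 \<partial>P) < 1"
    and "\<alpha> > 0"
  shows "AE \<omega> in P. \<forall>(M :: 'a measure) X \<eta>0.
           quenched_system M \<omega> X \<eta>0 \<and> distr M config_space \<eta>0 = config_law \<alpha> \<omega> \<longrightarrow>
           (\<forall>n. distr M config_space (particles X \<eta>0 n) = config_law \<alpha> \<omega>)"
  \<comment> \<open>The exceptional null set is that of non-regular environments. It is independent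
    of \<open>M\<close>, \<open>X\<close> and \<open>\<eta>0\<close>, so these can be quantified
    inside the almost-sure statement.\<close>
  using AE_regular_env[OF assms(1-6)]
  by eventually_elim (use particles_law assms(7) in blast)

end
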